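(* Let $F$ be a finite field and let $E_1,E_2\subset F$ with $|E_1||E_2|>6|F|$. Then there exist $u,y\in F$, $y\neq0$, such that $u+y\in E_1$ and $uy\in E_2$. More precisely, for each nonnegative integer $s<\min(|E_1|,|E_2|)$ there is a set $D\subset F^*$ with $$|D|\geq\frac{|E_1||E_2||F^*|/|F|-\sqrt{6|E_1||E_2||F^*|}-s|F^*|}{\min(|E_1|,|E_2|)-s}$$ such that for each $u\in D$ there are at least $s$ elements $y\in F$ with $u+y\in E_1$ and $uy\in E_2$.
   Context: $F^*=F\setminus\{0\}$. *)

theory Defs
  imports Complex_Main "HOL-Library.Cardinality"
begin

definition nonzero_elements :: "'a::zero set" where
  "nonzero_elements = UNIV - {0}"

end

theory Submission
  imports Defs "HOL-Analysis.Convex"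
begin

text \<open>
  The number of roots of \<open>x\<^sup>2 - a x + b\<close> has mean 1 over \<open>b\<close>, and its correlations for two
  values \<open>a, a'\<close> count the points of a conic. Bounding the second moment and applying
  Cauchy--Schwarz shows that the number \<open>M\<close> of pairs \<open>(u, y)\<close> with \<open>u + y \<in> E1\<close>, \<open>u y \<in> E2\<close>
  differs from \<open>P = |E1| |E2|\<close> by at most \<open>sqrt (2 |F| P)\<close>. The pairs with \<open>u = 0\<close> contribute at most
  \<open>|E1|\<close>, which the slack between the constants 2 and 6 absorbs; the set \<open>D\<close> then comes from pigeonhole.
\<close>

text \<open>\<open>x * (a - x) = b\<close> says that \<open>x\<close> and \<open>a - x\<close> have
  sum \<open>a\<close> and product \<open>b\<close>, so this counts the distinct roots of
  \<open>x^2 - a x + b\<close>. The real-valued sum of indicators lets sums be swapped and the mean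
  1 be subtracted.\<close>

definition num_roots :: "'a::{field,finite} \<Rightarrow> 'a \<Rightarrow> real" where
  "num_roots a b = (\<Sum>x\<in>UNIV. of_bool (x * (a - x) = b))"

lemma sum_num_roots: "(\<Sum>b\<in>UNIV. num_roots a b) = real CARD('a)"
  for a :: "'a::{field,finite}"
  unfolding num_roots_def by (subst sum.swap) simp

lemma sum_num_roots_mult:
  "(\<Sum>b\<in>UNIV. num_roots a b * num_roots c b) =
    (\<Sum>x\<in>UNIV. \<Sum>w\<in>UNIV. of_bool (x * (a - x) = w * (c - w)))"
  for a c :: "'a::{field,finite}"
proof -
  have "(\<Sum>b\<in>UNIV. num_roots a b * num_roots c b) =
    (\<Sum>b\<in>UNIV. \<Sum>x\<in>UNIV. \<Sum>w\<in>UNIV. of_bool (x * (a - x) = b) * of_bool (w * (c - w) = b))"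
    unfolding num_roots_def sum_product ..
  also have "\<dots> = (\<Sum>x\<in>UNIV. \<Sum>b\<in>UNIV. \<Sum>w\<in>UNIV. of_bool (x * (a - x) = b) * of_bool (w * (c - w) = b))"
    by (rule sum.swap)
  also have "\<dots> = (\<Sum>x\<in>UNIV. \<Sum>w\<in>UNIV. \<Sum>b\<in>UNIV. of_bool (x * (a - x) = b) * of_bool (w * (c - w) = b))"
    by (intro sum.cong refl sum.swap)
  also have "\<dots> = (\<Sum>x\<in>UNIV. \<Sum>w\<in>UNIV. of_bool (x * (a - x) = w * (c - w)))"
  proof (intro sum.cong refl)
    fix x w :: 'a
    have "(\<Sum>b\<in>UNIV. of_bool (x * (a - x) = b) * of_bool (w * (c - w) = b)) =
      (\<Sum>b\<in>UNIV. if b = x * (a - x) then of_bool (w * (c - w) = b) else (0::real))"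
      by (intro sum.cong refl) auto
    also have "\<dots> = of_bool (x * (a - x) = w * (c - w))"
      by (subst sum.delta) (simp_all add: eq_commute)
    finally show "(\<Sum>b\<in>UNIV. of_bool (x * (a - x) = b) * of_bool (w * (c - w) = b)) =
      (of_bool (x * (a - x) = w * (c - w)) :: real)" .
  qed
  finally show ?thesis .
qed

text \<open>With \<open>w = x + z\<close> the equation of the conic is linear in \<open>x\<close> for each \<open>z\<close>, in every
  characteristic.\<close>

lemma conic_points_le:
  "(\<Sum>x\<in>UNIV. \<Sum>w\<in>UNIV. of_bool (x * (a - x) = w * (c - w))) \<le>
    real CARD('a) + real CARD('a) * of_bool (c = a) + real CARD('a) * of_bool (c = - a)"
  for a c :: "'a::{field,finite}"
proof -
  let ?q = "real CARD('a)"
  have "(\<Sum>x\<in>UNIV. \<Sum>w\<in>UNIV. of_bool (x * (a - x) = w * (c - w))) =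
    (\<Sum>x\<in>UNIV. \<Sum>z\<in>UNIV. (of_bool (x * (a - x) = (x + z) * (c - (x + z))) :: real))"
  proof (rule sum.cong[OF refl])
    fix x :: 'a
    show "(\<Sum>w\<in>UNIV. of_bool (x * (a - x) = w * (c - w))) =
      (\<Sum>z\<in>UNIV. (of_bool (x * (a - x) = (x + z) * (c - (x + z))) :: real))"
      by (rule sum.reindex_bij_witness[of _ "\<lambda>z. x + z" "\<lambda>w. w - x"]) auto
  qed
  also have "\<dots> = (\<Sum>z\<in>UNIV. \<Sum>x\<in>UNIV. of_bool (x * (a - x) = (x + z) * (c - (x + z))))"
    by (rule sum.swap)
  \<comment> \<open>For fixed \<open>z\<close> the equation is
    \<open>x * (2 * z + a - c) = z * (c - z)\<close>: at most one solution unless both sides vanish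
    identically. That needs \<open>z = 0\<close> or \<open>z = c\<close>, and the zero coefficient
    then forces \<open>c = a\<close> or \<open>c = - a\<close> respectively; in these cases all of
    the field is allowed for.\<close>
  also have "\<dots> \<le> (\<Sum>z\<in>UNIV. 1 + ?q * of_bool (z = 0 \<and> c = a) + ?q * of_bool (z = c \<and> c = - a))"
  proof (rule sum_mono)
    fix z :: 'a
    have eq: "x * (a - x) = (x + z) * (c - (x + z)) \<longleftrightarrow> x * (2 * z + a - c) = z * (c - z)" for x
    proof -
      have "x * (a - x) - (x + z) * (c - (x + z)) = x * (2 * z + a - c) - z * (c - z)"
        by (simp add: algebra_simps)
      then show ?thesis by (metis eq_iff_diff_eq_0)
    qed
    have card: "(\<Sum>x\<in>UNIV. of_bool (x * (a - x) = (x + z) * (c - (x + z)))) =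
      real (card {x. x * (2 * z + a - c) = z * (c - z)})"
      unfolding eq by simp
    show "(\<Sum>x\<in>UNIV. of_bool (x * (a - x) = (x + z) * (c - (x + z)))) \<le>
      1 + ?q * of_bool (z = 0 \<and> c = a) + ?q * of_bool (z = c \<and> c = - a)"
    proof (cases "2 * z + a - c = 0")
      case False
      then have "{x. x * (2 * z + a - c) = z * (c - z)} \<subseteq> {z * (c - z) / (2 * z + a - c)}"
        by (auto simp: field_simps)
      then have "card {x. x * (2 * z + a - c) = z * (c - z)} \<le> 1"
        using card_mono[of "{z * (c - z) / (2 * z + a - c)}"] by fastforce
      then show ?thesis unfolding card by simp
    next
      case True
      let ?N = "card {x. x * (2 * z + a - c) = z * (c - z)}"
      have bound: "?N \<le> CARD('a)"
        by (intro card_mono) auto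
      consider "z \<noteq> 0" "z \<noteq> c" | "z = 0" | "z = c" by blast
      then show ?thesis
      proof cases
        case 1
        then have "?N = 0" using True by simp
        then show ?thesis unfolding card by simp
      next
        case 2
        then have "z = 0 \<and> c = a" using True by simp
        then have "of_bool (z = 0 \<and> c = a) = (1::real)" by (rule of_bool_eq_1_iff[THEN iffD2])
        then show ?thesis unfolding card using bound by (simp only: mult_1_right) simp
      next
        case 3
        then have "z = c \<and> c = - a" using True
          by (simp add: algebra_simps eq_neg_iff_add_eq_0)
        then have "of_bool (z = c \<and> c = - a) = (1::real)" by (rule of_bool_eq_1_iff[THEN iffD2])
        then show ?thesis unfolding card using bound by (simp only: mult_1_right) simp
      qed
    qed
  qed
  also have "\<dots> = ?q + ?q * of_bool (c = a) + ?q * of_bool (c = - a)"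
  proof -
    have delta: "(\<Sum>z\<in>UNIV. of_bool (z = v \<and> B)) = (of_bool B :: real)" for v :: 'a and B
      by (cases B) (simp_all add: of_bool_def)
    show ?thesis by (simp only: sum.distrib sum_distrib_left[symmetric] delta sum_constant mult_1_right)
  qed
  finally show ?thesis .
qed

text \<open>Expanding the square gives covariances over pairs \<open>a\<close>, \<open>c\<close> in
  \<open>E\<close>. For each \<open>a\<close> only \<open>c = a\<close> and \<open>c = - a\<close>
  contribute to the bound, at most |F| each, whence the factor 2.\<close>

lemma num_roots_second_moment_le:
  "(\<Sum>b\<in>UNIV. (\<Sum>a\<in>E. num_roots a b - 1)\<^sup>2) \<le> 2 * real CARD('a) * real (card E)"
  for E :: "'a::{field,finite} set"
proof -
  let ?q = "real CARD('a)"
  \<comment> \<open>Centering at the mean cancels the main term \<open>?q\<close> of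
    \<open>conic_points_le\<close>; only the degenerate cases survive.\<close>
  have cov: "(\<Sum>b\<in>UNIV. (num_roots a b - 1) * (num_roots c b - 1)) \<le>
    ?q * of_bool (c = a) + ?q * of_bool (c = - a)" for a c :: 'a
  proof -
    have "(\<Sum>b\<in>UNIV. (num_roots a b - 1) * (num_roots c b - 1)) =
      (\<Sum>b\<in>UNIV. num_roots a b * num_roots c b) - (\<Sum>b\<in>UNIV. num_roots a b)
        - (\<Sum>b\<in>UNIV. num_roots c b) + ?q"
      by (simp add: algebra_simps sum.distrib sum_subtractf)
    then show ?thesis
      using conic_points_le[of a c] by (simp add: sum_num_roots sum_num_roots_mult)
  qed
  have single: "(\<Sum>c\<in>E. of_bool (c = v)) \<le> (1::real)" for v :: 'a
    by (cases "v \<in> E") (simp_all add: of_bool_def)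
  have "(\<Sum>b\<in>UNIV. (\<Sum>a\<in>E. num_roots a b - 1)\<^sup>2) =
    (\<Sum>b\<in>UNIV. \<Sum>a\<in>E. \<Sum>c\<in>E. (num_roots a b - 1) * (num_roots c b - 1))"
    unfolding power2_eq_square sum_product ..
  also have "\<dots> = (\<Sum>a\<in>E. \<Sum>b\<in>UNIV. \<Sum>c\<in>E. (num_roots a b - 1) * (num_roots c b - 1))"
    by (rule sum.swap)
  also have "\<dots> = (\<Sum>a\<in>E. \<Sum>c\<in>E. \<Sum>b\<in>UNIV. (num_roots a b - 1) * (num_roots c b - 1))"
    by (intro sum.cong refl sum.swap)
  also have "\<dots> \<le> (\<Sum>a\<in>E. \<Sum>c\<in>E. ?q * of_bool (c = a) + ?q * of_bool (c = - a))"
    by (intro sum_mono cov)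
  also have "\<dots> \<le> (\<Sum>a\<in>E. 2 * ?q)"
  proof (rule sum_mono)
    fix a
    have "(\<Sum>c\<in>E. ?q * of_bool (c = a) + ?q * of_bool (c = - a)) =
      ?q * ((\<Sum>c\<in>E. of_bool (c = a)) + (\<Sum>c\<in>E. of_bool (c = - a)))"
      by (simp only: sum.distrib sum_distrib_left[symmetric] distrib_left)
    also have "\<dots> \<le> ?q * (1 + 1)"
      by (intro mult_left_mono add_mono single) simp
    finally show "(\<Sum>c\<in>E. ?q * of_bool (c = a) + ?q * of_bool (c = - a)) \<le> 2 * ?q" by simp
  qed
  also have "\<dots> = 2 * ?q * real (card E)" by simp
  finally show ?thesis .
qed

text \<open>A pair \<open>(u, y)\<close> is the same as a root \<open>u\<close> of the quadratic
  with \<open>a = u + y\<close> and \<open>b = u * y\<close>; for fixed \<open>u\<close>, the shift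
  \<open>a - u\<close> recovers \<open>y\<close>.\<close>

lemma sum_card_pairs_eq:
  "(\<Sum>u\<in>UNIV. real (card {y. u + y \<in> E1 \<and> u * y \<in> E2})) =
    (\<Sum>b\<in>E2. \<Sum>a\<in>E1. num_roots a b)"
  for E1 E2 :: "'a::{field,finite} set"
proof -
  have "(\<Sum>b\<in>E2. \<Sum>a\<in>E1. num_roots a b) = (\<Sum>b\<in>E2. \<Sum>x\<in>UNIV. \<Sum>a\<in>E1. of_bool (x * (a - x) = b))"
    unfolding num_roots_def by (intro sum.cong refl sum.swap)
  also have "\<dots> = (\<Sum>x\<in>UNIV. \<Sum>b\<in>E2. \<Sum>a\<in>E1. of_bool (x * (a - x) = b))"
    by (rule sum.swap)
  also have "\<dots> = (\<Sum>x\<in>UNIV. \<Sum>a\<in>E1. \<Sum>b\<in>E2. of_bool (x * (a - x) = b))"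
    by (intro sum.cong refl sum.swap)
  also have "\<dots> = (\<Sum>u\<in>UNIV. real (card {y. u + y \<in> E1 \<and> u * y \<in> E2}))"
  proof (rule sum.cong[OF refl])
    fix u :: 'a
    have "(\<Sum>a\<in>E1. \<Sum>b\<in>E2. of_bool (u * (a - u) = b)) = (\<Sum>a\<in>E1. of_bool (u * (a - u) \<in> E2) :: real)"
      by (intro sum.cong refl) (simp add: of_bool_def)
    also have "\<dots> = real (card {a \<in> E1. u * (a - u) \<in> E2})"
      by (simp add: Int_def)
    also have "card {a \<in> E1. u * (a - u) \<in> E2} = card {y. u + y \<in> E1 \<and> u * y \<in> E2}"
      by (rule bij_betw_same_card[of "\<lambda>a. a - u"], rule bij_betw_byWitness[of _ "\<lambda>y. u + y"]) auto
    finally show "(\<Sum>a\<in>E1. \<Sum>b\<in>E2. of_bool (u * (a - u) = b)) =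
      real (card {y. u + y \<in> E1 \<and> u * y \<in> E2})" .
  qed
  finally show ?thesis by simp
qed

lemma sum_card_pairs_ge:
  "(\<Sum>u\<in>UNIV. real (card {y. u + y \<in> E1 \<and> u * y \<in> E2})) \<ge>
    real (card E1 * card E2) - sqrt (2 * real CARD('a) * real (card E1 * card E2))"
  for E1 E2 :: "'a::{field,finite} set"
proof -
  let ?h = "\<lambda>b. \<Sum>a\<in>E1. num_roots a b - 1"
  have "(\<Sum>b\<in>E2. ?h b)\<^sup>2 \<le> real (card E2) * (\<Sum>b\<in>E2. (?h b)\<^sup>2)"
    using Cauchy_Schwarz_ineq_sum[of "\<lambda>_. 1" ?h E2] by simp
  \<comment> \<open>Squares are nonnegative, so the sum may be extended to the whole field, where
    the second moment is known.\<close>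
  also have "\<dots> \<le> real (card E2) * (\<Sum>b\<in>UNIV. (?h b)\<^sup>2)"
    by (intro mult_left_mono sum_mono2) auto
  also have "\<dots> \<le> real (card E2) * (2 * real CARD('a) * real (card E1))"
    by (intro mult_left_mono num_roots_second_moment_le) simp
  finally have "\<bar>\<Sum>b\<in>E2. ?h b\<bar> \<le> sqrt (2 * real CARD('a) * real (card E1 * card E2))"
    by (intro real_le_rsqrt) (simp add: mult_ac)
  moreover have "(\<Sum>b\<in>E2. ?h b) = (\<Sum>b\<in>E2. \<Sum>a\<in>E1. num_roots a b) - real (card E1 * card E2)"
    by (simp add: sum_subtractf)
  ultimately show ?thesis unfolding sum_card_pairs_eq by linarith
qed

theorem theorem5p3:
  fixes E1 E2 :: "'a :: {field, finite} set"
  assumes "card E1 * card E2 > 6 * CARD('a)"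
  shows "(\<exists>u y :: 'a. y \<noteq> 0 \<and> u + y \<in> E1 \<and> u * y \<in> E2) \<and>
    (\<forall>s :: nat. s < min (card E1) (card E2) \<longrightarrow>
      (\<exists>D \<subseteq> (nonzero_elements :: 'a set).
        real (card D) \<ge>
          (real (card E1) * real (card E2) * real (card (nonzero_elements :: 'a set)) / real CARD('a)
            - sqrt (6 * real (card E1) * real (card E2) * real (card (nonzero_elements :: 'a set)))
            - real s * real (card (nonzero_elements :: 'a set)))
          / (real (min (card E1) (card E2)) - real s) \<and>
        (\<forall>u \<in> D. card {y :: 'a. u + y \<in> E1 \<and> u * y \<in> E2} \<ge> s)))"
proof -
  define q where "q = real CARD('a)"
  define e where "e = real (card E1)"
  define P where "P = real (card E1 * card E2)"
  define m where "m = min (card E1) (card E2)"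
  define c where "c = (\<lambda>u. card {y. u + y \<in> E1 \<and> u * y \<in> E2})"
  let ?F = "nonzero_elements :: 'a set"
  have q_pos: "q > 0" by (simp add: q_def card_gt_0_iff)
  have P_gt: "P > 6 * q" using assms unfolding P_def q_def by linarith
  have e_le: "e \<le> q" unfolding e_def q_def by (simp add: card_mono)
  have P_ge: "P \<ge> 6 * e"
    using P_gt e_le by linarith
  \<comment> \<open>The hypothesis forces the field to be large:
    \<open>6 * q < P \<le> q * q\<close>. This later gives
    \<open>4 * q \<le> 6 * (q - 1)\<close>.\<close>
  have "real (card E2) \<le> q" unfolding q_def by (simp add: card_mono)
  then have "P \<le> q * q" unfolding P_def using e_le by (simp add: mult_mono e_def)
  then have "6 * q < q * q" using P_gt by linarith
  then have q_gt: "q > 6" using q_pos by simp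
  have card_F: "real (card ?F) = q - 1"
  proof -
    have "card ?F = CARD('a) - 1" by (simp add: nonzero_elements_def)
    then show ?thesis using q_gt unfolding q_def by simp
  qed
  \<comment> \<open>\<open>S\<close> is the unit for all errors: \<open>sqrt (2 * q * P)\<close> is
    at most \<open>3 / 2 * S\<close> because 2 < 9/4, and the pairs with \<open>u = 0\<close> cost
    at most \<open>e \<le> S / 2\<close>, so the total loss is at most \<open>2 * S\<close>.\<close>
  define S where "S = sqrt (q * P)"
  have S_ge: "S \<ge> 2 * e"
    unfolding S_def
  proof (rule real_le_rsqrt)
    have "q * P \<ge> e * (6 * e)" using e_le P_ge q_pos by (intro mult_mono) (auto simp: e_def)
    moreover have "4 * (e * e) \<le> e * (6 * e)" by simp
    ultimately have "4 * (e * e) \<le> q * P" by (rule order_trans[rotated])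
    then show "(2 * e)\<^sup>2 \<le> q * P" by (simp add: power2_eq_square)
  qed
  have N_split: "(\<Sum>u\<in>UNIV. real (c u)) = real (c 0) + (\<Sum>u\<in>?F. real (c u))"
    unfolding nonzero_elements_def by (rule sum.remove) auto
  have c0: "real (c 0) \<le> e"
    unfolding c_def e_def by (simp add: card_mono)
  have "sqrt (2 * q * P) \<le> 3 / 2 * S"
    unfolding S_def
    by (rule real_le_lsqrt) (use q_pos P_gt in \<open>auto simp: power_mult_distrib power2_eq_square\<close>)
  then have N_ge: "(\<Sum>u\<in>?F. real (c u)) \<ge> P - 2 * S"
    using sum_card_pairs_ge[of E1 E2] N_split c0 S_ge
    by (simp add: c_def P_def q_def)
  have two_S: "2 * S < P"
  proof -
    have "4 * (q * P) < P * P" using q_pos P_gt by (simp add: mult_strict_right_mono)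
    then have "sqrt (4 * (q * P)) < P"
      by (intro real_less_lsqrt) (use q_pos P_gt in \<open>auto simp: power2_eq_square\<close>)
    then show ?thesis unfolding S_def by (simp add: real_sqrt_mult)
  qed
  have "\<exists>u y :: 'a. y \<noteq> 0 \<and> u + y \<in> E1 \<and> u * y \<in> E2"
  proof -
    have "(\<Sum>u\<in>?F. real (c u)) \<noteq> 0" using N_ge two_S by linarith
    then obtain v where v: "v \<in> ?F" "c v \<noteq> 0" by (metis of_nat_0 sum.neutral)
    then have "{y. v + y \<in> E1 \<and> v * y \<in> E2} \<noteq> {}" unfolding c_def by (metis card.empty)
    then obtain y where "v + y \<in> E1" "v * y \<in> E2" by blast
    \<comment> \<open>The element known to be nonzero is \<open>v\<close>, while the claim wants
      \<open>y\<close> nonzero. Sum and product are symmetric, so the two exchange roles.\<close>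
    then show ?thesis
      using v(1) unfolding nonzero_elements_def by (metis DiffE add.commute insertI1 mult.commute)
  qed
  moreover have "\<exists>D \<subseteq> ?F.
        real (card D) \<ge>
          (real (card E1) * real (card E2) * real (card ?F) / real CARD('a)
            - sqrt (6 * real (card E1) * real (card E2) * real (card ?F))
            - real s * real (card ?F))
          / (real (min (card E1) (card E2)) - real s) \<and>
        (\<forall>u \<in> D. card {y :: 'a. u + y \<in> E1 \<and> u * y \<in> E2} \<ge> s)"
    if s: "s < min (card E1) (card E2)" for s
  proof -
    \<comment> \<open>Pigeonhole: each \<open>u\<close> outside \<open>D\<close> contributes at most
      \<open>s\<close> pairs and each \<open>u\<close> in \<open>D\<close> at most \<open>m\<close>,
      so a large total forces \<open>D\<close> to be large.\<close>
    define D where "D = {u \<in> ?F. s \<le> c u}"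
    have sub: "D \<subseteq> ?F" unfolding D_def by blast
    have c_le: "c u \<le> m" if "u \<in> ?F" for u
    proof -
      have "c u \<le> card E1" unfolding c_def
        by (rule card_inj_on_le[of "\<lambda>y. u + y"]) auto
      \<comment> \<open>Multiplication by \<open>u\<close> is injective because \<open>u\<close> is
        nonzero; at \<open>u = 0\<close> this bound can fail.\<close>
      moreover have "c u \<le> card E2" unfolding c_def
        by (rule card_inj_on_le[of "\<lambda>y. u * y"])
          (use that in \<open>auto simp: nonzero_elements_def inj_on_def\<close>)
      ultimately show ?thesis unfolding m_def by simp
    qed
    have "(\<Sum>u\<in>?F. real (c u)) = (\<Sum>u\<in>?F - D. real (c u)) + (\<Sum>u\<in>D. real (c u))"
      using sub by (intro sum.subset_diff) auto
    also have "\<dots> \<le> (\<Sum>u\<in>?F - D. real s) + (\<Sum>u\<in>D. real m)"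
      using c_le sub by (intro add_mono sum_mono) (auto simp: D_def)
    also have "\<dots> = (q - 1 - real (card D)) * real s + real (card D) * real m"
      using sub card_F by (simp add: card_Diff_subset of_nat_diff card_mono)
    finally have upper: "(\<Sum>u\<in>?F. real (c u)) \<le> real s * (q - 1) + real (card D) * (real m - real s)"
      by (simp add: algebra_simps)
    have "2 * S \<le> sqrt (6 * P * (q - 1))"
    proof -
      have "4 * (q * P) \<le> 6 * P * (q - 1)"
      proof -
        have "P * (4 * q) \<le> P * (6 * (q - 1))" using q_gt P_gt by (intro mult_left_mono) auto
        then show ?thesis by (simp add: mult_ac)
      qed
      then have "sqrt (4 * (q * P)) \<le> sqrt (6 * P * (q - 1))" by (rule real_sqrt_le_mono)
      then show ?thesis unfolding S_def by (simp add: real_sqrt_mult)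
    qed
    \<comment> \<open>The main term in the claim is smaller than the \<open>P\<close> available in
      \<open>N_ge\<close>, and its error term dominates \<open>2 * S\<close>.\<close>
    moreover have "P * (q - 1) / q \<le> P" using q_pos P_gt by (simp add: field_simps)
    ultimately have "P * (q - 1) / q - sqrt (6 * P * (q - 1)) - real s * (q - 1)
      \<le> real (card D) * (real m - real s)"
      using upper N_ge by linarith
    then have "(P * (q - 1) / q - sqrt (6 * P * (q - 1)) - real s * (q - 1)) / (real m - real s)
      \<le> real (card D)"
      using s by (simp add: m_def divide_le_eq)
    moreover have "\<forall>u\<in>D. card {y :: 'a. u + y \<in> E1 \<and> u * y \<in> E2} \<ge> s"
      unfolding D_def c_def by blast
    ultimately show ?thesis
      using sub unfolding card_F by (intro exI[of _ D]) (simp add: P_def m_def q_def mult_ac)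
  qed
  ultimately show ?thesis by blast
qed

end
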